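(* As formal power series in $x$ and $y$, $$\sum_{n\geq 1}\sum_{k=0}^{n-1}R(n+k-1,k)\,x^ny^{k}=\sum_{n\geq 1} \frac{x^n}{(1-xy)^{\binom{n+1}{2}}},$$ where $R(m,k)$ is the number of partial matchings of $[m]$ with exactly $k$ arcs, no neighbor alignments, no left nestings and no right nestings.
   Context: Write $[m]=\{1,2,\ldots,m\}$, with $[0]=\emptyset$; the empty set has exactly one partial matching (the empty one, with $0$ arcs), so $R(0,0)=1$. A partition $\pi$ of $[m]$ (set partition into nonempty blocks) is represented by a diagram with vertices $1,\ldots,m$: for each block $B=\{i_1<i_2<\cdots<i_r\}$ one draws the arcs $(i_1,i_2),(i_2,i_3),\ldots,(i_{r-1},i_r)$. A partial matching of $[m]$ is a partition of $[m]$ in which each block has at most two elements; its arcs are the pairs $(i,j)$, $i<j$, such that $\{i,j\}$ is a block. A neighbor alignment is a pair of arcs $(i_1,j_1),(i_2,j_2)$ with $i_1<j_1<i_2<j_2$ and $j_1+1=i_2$. A nesting is a pair of arcs $(i_1,j_1),(i_2,j_2)$ with $i_1<i_2<j_2<j_1$; it is a left nesting if $i_1+1=i_2$ and a right nesting if $j_2+1=j_1$. *)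

theory Defs
  imports
    "HOL-Library.Disjoint_Sets"
    "HOL-Computational_Algebra.Formal_Power_Series"
    "HOL-Analysis.Infinite_Sum"
begin

definition partial_matching :: "nat \<Rightarrow> nat set set \<Rightarrow> bool" where
  "partial_matching m P \<longleftrightarrow> partition_on {1..m} P \<and> (\<forall>B\<in>P. card B \<le> 2)"

definition arcs :: "nat set set \<Rightarrow> (nat \<times> nat) set" where
  "arcs P = {(i, j). i < j \<and> {i, j} \<in> P}"

definition neighbor_alignment :: "nat \<times> nat \<Rightarrow> nat \<times> nat \<Rightarrow> bool" where
  "neighbor_alignment a b \<longleftrightarrow>
     (case (a, b) of ((i1, j1), (i2, j2)) \<Rightarrow> i1 < j1 \<and> j1 < i2 \<and> i2 < j2 \<and> j1 + 1 = i2)"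

definition nesting :: "nat \<times> nat \<Rightarrow> nat \<times> nat \<Rightarrow> bool" where
  "nesting a b \<longleftrightarrow>
     (case (a, b) of ((i1, j1), (i2, j2)) \<Rightarrow> i1 < i2 \<and> i2 < j2 \<and> j2 < j1)"

definition left_nesting :: "nat \<times> nat \<Rightarrow> nat \<times> nat \<Rightarrow> bool" where
  "left_nesting a b \<longleftrightarrow> nesting a b \<and> fst a + 1 = fst b"

definition right_nesting :: "nat \<times> nat \<Rightarrow> nat \<times> nat \<Rightarrow> bool" where
  "right_nesting a b \<longleftrightarrow> nesting a b \<and> snd b + 1 = snd a"

definition R :: "nat \<Rightarrow> nat \<Rightarrow> nat" where
  "R m k = card {P. partial_matching m P \<and> card (arcs P) = k \<and>
     (\<forall>a\<in>arcs P. \<forall>b\<in>arcs P.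
        \<not> neighbor_alignment a b \<and> \<not> left_nesting a b \<and> \<not> right_nesting a b)}"

text \<open>
  Formal power series in \<open>X\<close> and \<open>Y\<close> are series in \<open>X\<close> whose coefficients are series in \<open>Y\<close>.
  Infinite sums refer to the library's topology on the outer series type, the \<open>X\<close>-adic one.
\<close>

definition X :: "rat fps fps" where "X = fps_X"

definition Y :: "rat fps fps" where "Y = fps_const fps_X"

text \<open>
  The coefficients \<^typ>\<open>rat fps\<close> do not form a field, so the library's cancellation rules for
  \<open>/\<close> do not apply; dividing by a power of \<open>1 - X * Y\<close> is nevertheless genuine division.
\<close>

lemma divide_one_minus_xy_power:
  "f / (1 - X * Y) ^ m * (1 - X * Y) ^ m = f"
proof -
  define g where "g = (1 - X * Y) ^ m"
  have g0: "fps_nth g 0 = 1"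
    by (simp add: g_def X_def Y_def fps_nth_power_0)
  have "unit_factor g = g" and "subdegree g = 0"
    using g0 by (auto simp: fps_unit_factor_def subdegree_eq_0_iff)
  moreover have "g * inverse g = 1"
  proof -
    have "inverse (1 :: rat fps) = 1"
      by (rule fps_inverse_one)
    then have "inverse g = fps_right_inverse g 1"
      using g0 by (simp add: fps_inverse_def[of g] del: fps_inverse_one')
    then show ?thesis
      using g0 fps_right_inverse[of g 1] by simp
  qed
  ultimately show ?thesis
    unfolding g_def[symmetric] by (simp add: fps_divide_def mult.assoc mult.commute[of g])
qed

end

theory Submission
  imports Defs "HOL-Library.Product_Lexorder"
begin

text \<open>
  Cut the vertices of a partial matching with \<open>k\<close> arcs and \<open>s\<close> singletons into \<open>s + 1\<close> segments at the
  singletons. Without neighbor alignments each segment consists of openers followed by closers.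
  Without left (right) nestings, the arcs starting (ending) in a segment are ordered there
  by their other ends. Hence the matching is determined by the numbers \<open>M (p, q)\<close> of arcs
  from segment \<open>p\<close> to segment \<open>q\<close>, and these form an arbitrary upper triangular matrix with sum \<open>k\<close>.
  So there are \<open>(k + c - 1) choose k\<close> such matchings, where \<open>c = (s + 2) choose 2\<close>. This is
  the coefficient of \<open>(x y)\<^sup>k\<close> in \<open>1 / (1 - x y)\<^sup>c\<close>.
\<close>

subsection \<open>Counting triangular matrices\<close>

text \<open>Stars and bars: an enumeration \<open>ts\<close> of \<open>T\<close> turns the functions
  into lists of naturals with prescribed length and sum.\<close>

lemma card_weighted_functions:
  fixes T :: "'a set"
  assumes "finite T"
  shows "card {M :: 'a \<Rightarrow> nat. (\<forall>x. x \<notin> T \<longrightarrow> M x = 0) \<and> sum M T = k} = (k + card T - 1) choose k"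
proof -
  obtain ts where ts: "set ts = T" "distinct ts"
    using assms finite_distinct_list by blast
  let ?F = "{M :: 'a \<Rightarrow> nat. (\<forall>x. x \<notin> T \<longrightarrow> M x = 0) \<and> sum M T = k}"
  let ?L = "{l :: nat list. length l = length ts \<and> sum_list l = k}"
  have "bij_betw (\<lambda>M. map M ts) ?F ?L"
  \<comment> \<open>The inverse reads a list as a value table along \<open>ts\<close>; the default 0
    gives the vanishing outside \<open>T\<close>.\<close>
  proof (rule bij_betw_byWitness[where f' = "\<lambda>l x. case map_of (zip ts l) x of None \<Rightarrow> 0 | Some v \<Rightarrow> v"])
    show "\<forall>M\<in>?F. (\<lambda>x. case map_of (zip ts (map M ts)) x of None \<Rightarrow> 0 | Some v \<Rightarrow> v) = M"
      using ts by (auto simp: fun_eq_iff map_of_zip_map)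
    have *: "map (\<lambda>x. case map_of (zip ts l) x of None \<Rightarrow> 0 | Some v \<Rightarrow> v) ts = l"
      if "length l = length ts" for l :: "nat list"
      using that ts by (auto intro!: nth_equalityI simp: map_of_zip_nth)
    then show "\<forall>l\<in>?L. map (\<lambda>x. case map_of (zip ts l) x of None \<Rightarrow> 0 | Some v \<Rightarrow> v) ts = l"
      by blast
    show "(\<lambda>M. map M ts) ` ?F \<subseteq> ?L"
      using ts by (auto simp: sum.distinct_set_conv_list)
    show "(\<lambda>l x. case map_of (zip ts l) x of None \<Rightarrow> 0 | Some v \<Rightarrow> v) ` ?L \<subseteq> ?F"
    proof (clarsimp, intro conjI allI impI)
      fix l :: "nat list" and x
      assume l: "length l = length ts"
      { assume "x \<notin> T"
        with l ts have "map_of (zip ts l) x = None" by (simp add: map_of_zip_is_None)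
        then show "(case map_of (zip ts l) x of None \<Rightarrow> 0 | Some v \<Rightarrow> v) = 0" by simp }
      show "(\<Sum>x\<in>T. case map_of (zip ts l) x of None \<Rightarrow> 0 | Some v \<Rightarrow> v) = sum_list l"
        using ts *[OF l] by (metis sum.distinct_set_conv_list)
    qed
  qed
  then have "card ?F = card ?L"
    by (rule bij_betw_same_card)
  also have "\<dots> = (k + card T - 1) choose k"
    using ts by (simp add: card_length_sum_list distinct_card[symmetric])
  finally show ?thesis .
qed

lemma card_weak_upper_triangle: "card {(p, q). p \<le> q \<and> q \<le> s} = (s + 2) choose 2"
proof -
  have "{(p, q). p \<le> q \<and> q \<le> s} = (\<lambda>(q, p). (p, q)) ` (SIGMA q:{..s}. {..q})"
    by (auto simp: image_iff)
  then have "card {(p, q). p \<le> q \<and> q \<le> s} = (\<Sum>q\<le>s. Suc q)"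
    by (simp add: card_image inj_on_def split_beta prod_eq_iff)
  also have "\<dots> = (s + 2) choose 2"
    by (induction s) (simp_all add: numeral_2_eq_2)
  finally show ?thesis .
qed

lemma finite_weak_upper_triangle: "finite {(p, q). p \<le> q \<and> q \<le> (s :: nat)}"
  by (rule finite_subset[of _ "{..s} \<times> {..s}"]) auto

subsection \<open>Arc systems and lexicographic keys\<close>

text \<open>Matchings seen through their arcs only. The last three assumptions recast the forbidden
  patterns as conditions on neighboring vertices \<open>x\<close> and \<open>Suc x\<close>, in the
  form needed to compare keys.\<close>

locale arc_system =
  fixes m :: nat and A :: "(nat \<times> nat) set"
  assumes bounds: "(i, j) \<in> A \<Longrightarrow> 1 \<le> i \<and> i < j \<and> j \<le> m"
    and disjoint: "a \<in> A \<Longrightarrow> b \<in> A \<Longrightarrow> {fst a, snd a} \<inter> {fst b, snd b} \<noteq> {} \<Longrightarrow> a = b"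
    and no_alignment: "(i, x) \<in> A \<Longrightarrow> (Suc x, j) \<notin> A"
    and openers_increasing: "(x, j) \<in> A \<Longrightarrow> (Suc x, j') \<in> A \<Longrightarrow> j < j'"
    and closers_increasing: "(i, x) \<in> A \<Longrightarrow> (i', Suc x) \<in> A \<Longrightarrow> i < i'"

definition endpoints :: "(nat \<times> nat) set \<Rightarrow> nat set" where
  "endpoints A = fst ` A \<union> snd ` A"

text \<open>Segments are numbered from 0; a singleton does not count itself and so belongs to the
  segment that it ends.\<close>

definition segment :: "(nat \<times> nat) set \<Rightarrow> nat \<Rightarrow> nat" where
  "segment A x = card ({1..<x} - endpoints A)"

definition segments :: "(nat \<times> nat) set \<Rightarrow> nat \<times> nat \<Rightarrow> nat \<times> nat" where
  "segments A a = (segment A (fst a), segment A (snd a))"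

definition arc_matrix :: "(nat \<times> nat) set \<Rightarrow> nat \<times> nat \<Rightarrow> nat" where
  "arc_matrix A c = card {a \<in> A. segments A a = c}"

text \<open>In an arc system, arcs with the same two segments have openers and closers in the same
  order, so one rank serves the keys of both ends.\<close>

definition arc_rank :: "(nat \<times> nat) set \<Rightarrow> nat \<times> nat \<Rightarrow> nat" where
  "arc_rank A a = card {b \<in> A. segments A b = segments A a \<and> fst b < fst a}"

text \<open>
  Keys are compared lexicographically: first the segment, then the kind of the vertex (\<open>0\<close> opener,
  \<open>1\<close> closer, \<open>2\<close> the singleton that ends the segment), then the segment of the other end of the arc,
  then the rank of the arc among those with the same two segments.
\<close>

type_synonym key = "nat \<times> nat \<times> nat \<times> nat"

fun opener_key :: "nat \<times> nat \<times> nat \<Rightarrow> key" where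
  "opener_key (p, q, t) = (p, 0, q, t)"

fun closer_key :: "nat \<times> nat \<times> nat \<Rightarrow> key" where
  "closer_key (p, q, t) = (q, 1, p, t)"

definition single_key :: "nat \<Rightarrow> key" where
  "single_key r = (r, 2, 0, 0)"

text \<open>Each matrix entry is unfolded into labelled copies, one per future arc.\<close>

definition slots :: "(nat \<times> nat \<Rightarrow> nat) \<Rightarrow> (nat \<times> nat \<times> nat) set" where
  "slots M = {(p, q, t). t < M (p, q)}"

definition keys :: "nat \<Rightarrow> (nat \<times> nat \<Rightarrow> nat) \<Rightarrow> key set" where
  "keys s M = opener_key ` slots M \<union> closer_key ` slots M \<union> single_key ` {..<s}"

text \<open>Counting with \<open>\<le>\<close> gives the least element of \<open>K\<close> position
  1, matching vertices that start at 1.\<close>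

definition position :: "'a :: linorder set \<Rightarrow> 'a \<Rightarrow> nat" where
  "position K z = card {w \<in> K. w \<le> z}"

definition slot_arc :: "nat \<Rightarrow> (nat \<times> nat \<Rightarrow> nat) \<Rightarrow> nat \<times> nat \<times> nat \<Rightarrow> nat \<times> nat" where
  "slot_arc s M c = (position (keys s M) (opener_key c), position (keys s M) (closer_key c))"

definition matrix_arcs :: "nat \<Rightarrow> (nat \<times> nat \<Rightarrow> nat) \<Rightarrow> (nat \<times> nat) set" where
  "matrix_arcs s M = slot_arc s M ` slots M"

definition arc_systems :: "nat \<Rightarrow> nat \<Rightarrow> (nat \<times> nat) set set" where
  "arc_systems s k = {A. arc_system (2 * k + s) A \<and> card A = k}"

definition triangular_matrices :: "nat \<Rightarrow> nat \<Rightarrow> (nat \<times> nat \<Rightarrow> nat) set" where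
  "triangular_matrices s k = {M. (\<forall>c. c \<notin> {(p, q). p \<le> q \<and> q \<le> s} \<longrightarrow> M c = 0) \<and>
     sum M {(p, q). p \<le> q \<and> q \<le> s} = k}"

definition arc_slot :: "(nat \<times> nat) set \<Rightarrow> nat \<times> nat \<Rightarrow> nat \<times> nat \<times> nat" where
  "arc_slot A a = (segment A (fst a), segment A (snd a), arc_rank A a)"

text \<open>The key that \<open>x\<close> should have in the order built from
  \<open>arc_matrix A\<close>. Once this map is known to increase and to exhaust the keys,
  \<open>position\<close> inverts it.\<close>

definition vertex_key :: "(nat \<times> nat) set \<Rightarrow> nat \<Rightarrow> key" where
  "vertex_key A x =
    (if x \<in> fst ` A then opener_key (arc_slot A (THE a. a \<in> A \<and> fst a = x))
     else if x \<in> snd ` A then closer_key (arc_slot A (THE a. a \<in> A \<and> snd a = x))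
     else single_key (segment A x))"

subsection \<open>Ranks in finite linear orders\<close>

lemma position_strict_mono:
  assumes "finite K" "z \<in> K" "y < z"
  shows "position K y < position K z"
  unfolding position_def using assms by (intro psubset_card_mono) (auto simp: less_le_not_le intro: order.trans)

lemma position_less_iff:
  assumes "finite K" "y \<in> K" "z \<in> K"
  shows "position K y < position K z \<longleftrightarrow> y < z"
  using assms position_strict_mono[of K] by (metis less_asym neqE)

lemma position_eq_iff:
  assumes "finite K" "y \<in> K" "z \<in> K"
  shows "position K y = position K z \<longleftrightarrow> y = z"
  using assms position_strict_mono[of K] by (metis less_irrefl neqE)

lemma bij_betw_position:
  assumes "finite K"
  shows "bij_betw (position K) K {1..card K}"
proof -
  have inj: "inj_on (position K) K"
    using position_eq_iff[OF assms] by (auto simp: inj_on_def)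
  moreover have "position K ` K \<subseteq> {1..card K}"
  proof clarify
    fix z assume z: "z \<in> K"
    then have "{w \<in> K. w \<le> z} \<noteq> {}" by blast
    then have "0 < card {w \<in> K. w \<le> z}" using assms by (simp add: card_gt_0_iff)
    then show "position K z \<in> {1..card K}"
      using assms by (auto simp: position_def intro!: card_mono)
  qed
  ultimately have "position K ` K = {1..card K}"
    by (intro card_subset_eq) (auto simp: card_image)
  with inj show ?thesis by (simp add: bij_betw_def)
qed

text \<open>The elements at or below \<open>f x\<close> are the images of \<open>1..x\<close>. Hence
  an increasing enumeration of the keys determines all positions.\<close>

lemma position_unique:
  assumes "strict_mono_on {1..m} f" "x \<in> {1..m}"
  shows "position (f ` {1..m}) (f x) = x"
proof -
  have inj: "inj_on f {1..m}"
    using assms(1) by (rule strict_mono_on_imp_inj_on)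
  have "{w \<in> f ` {1..m}. w \<le> f x} = f ` {1..x}"
  proof -
    have "f y \<le> f x \<longleftrightarrow> y \<le> x" if "y \<in> {1..m}" for y
      using strict_mono_on_leD[OF assms(1)] strict_mono_onD[OF assms(1)] assms(2) that
      by (metis leD not_le_imp_less)
    with assms(2) show ?thesis by auto
  qed
  moreover have "inj_on f {1..x}"
    using inj assms(2) by (auto intro: inj_on_subset)
  ultimately show ?thesis by (simp add: position_def card_image)
qed

subsection \<open>From matrices to arc systems\<close>

lemma slots_eq_Sigma:
  assumes "\<And>c. c \<notin> T \<Longrightarrow> M c = 0"
  shows "slots M = (\<lambda>((p, q), t). (p, q, t)) ` (SIGMA c:T. {..<M c})"
proof -
  have "(p, q) \<in> T" if "t < M (p, q)" for p q t
    using assms[of "(p, q)"] that by auto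
  then show ?thesis by (force simp: slots_def)
qed

lemma opener_key_inj: "opener_key c = opener_key d \<longleftrightarrow> c = d"
  by (cases c; cases d) auto

lemma closer_key_inj: "closer_key c = closer_key d \<longleftrightarrow> c = d"
  by (cases c; cases d) auto

lemma key_kinds_distinct:
  "opener_key c \<noteq> closer_key d" "opener_key c \<noteq> single_key r" "closer_key c \<noteq> single_key r"
  by (cases c; cases d; simp add: single_key_def)+

lemma keys_intros:
  "c \<in> slots M \<Longrightarrow> opener_key c \<in> keys s M"
  "c \<in> slots M \<Longrightarrow> closer_key c \<in> keys s M"
  "r < s \<Longrightarrow> single_key r \<in> keys s M"
  by (auto simp: keys_def)

lemma inj_reassoc: "inj_on (\<lambda>((p, q), t). (p, q, t)) B"
  by (auto simp: inj_on_def)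

context
  fixes s k :: nat and M :: "nat \<times> nat \<Rightarrow> nat"
  assumes M: "M \<in> triangular_matrices s k"
begin

lemma slot_bounds:
  assumes "(p, q, t) \<in> slots M"
  shows "p \<le> q \<and> q \<le> s \<and> t < M (p, q)"
proof -
  have t: "t < M (p, q)" using assms by (simp add: slots_def)
  moreover have "M (p, q) = 0" if "(p, q) \<notin> {(p, q). p \<le> q \<and> q \<le> s}"
    using M that unfolding triangular_matrices_def by blast
  ultimately have "(p, q) \<in> {(p, q). p \<le> q \<and> q \<le> s}" by force
  with t show ?thesis by simp
qed

lemma finite_card_slots: "finite (slots M) \<and> card (slots M) = k"
proof -
  have *: "slots M = (\<lambda>((p, q), t). (p, q, t)) ` (SIGMA c:{(p, q). p \<le> q \<and> q \<le> s}. {..<M c})"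
  proof (rule slots_eq_Sigma)
    fix c assume "c \<notin> {(p, q). p \<le> q \<and> q \<le> s}"
    with M show "M c = 0" unfolding triangular_matrices_def by (cases c) simp
  qed
  have "sum M {(p, q). p \<le> q \<and> q \<le> s} = k"
    using M by (simp only: triangular_matrices_def mem_Collect_eq)
  then have "card (SIGMA c:{(p, q). p \<le> q \<and> q \<le> s}. {..<M c}) = k"
    using finite_weak_upper_triangle[of s] by (subst card_SigmaI) auto
  moreover have "finite (SIGMA c:{(p, q). p \<le> q \<and> q \<le> s}. {..<M c})"
    using finite_weak_upper_triangle[of s] by (rule finite_SigmaI) simp
  ultimately show ?thesis
    unfolding * by (simp only: card_image[OF inj_reassoc] finite_imageI simp_thms)
qed

lemma finite_card_keys: "finite (keys s M) \<and> card (keys s M) = 2 * k + s"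
proof -
  have "card (opener_key ` slots M) = k" "card (closer_key ` slots M) = k" "card (single_key ` {..<s}) = s"
    using finite_card_slots
    by (auto simp: card_image inj_on_def opener_key_inj closer_key_inj single_key_def)
  moreover have "opener_key ` slots M \<inter> closer_key ` slots M = {}"
    "(opener_key ` slots M \<union> closer_key ` slots M) \<inter> single_key ` {..<s} = {}"
    using key_kinds_distinct by blast+
  ultimately show ?thesis
    unfolding keys_def using finite_card_slots by (subst card_Un_disjoint; simp add: card_Un_disjoint)
qed

lemma finite_keys: "finite (keys s M)"
  using finite_card_keys by blast

abbreviation pos :: "key \<Rightarrow> nat" where "pos \<equiv> position (keys s M)"

lemmas pos_less_iff = position_less_iff[OF finite_keys]
lemmas pos_eq_iff = position_eq_iff[OF finite_keys]

lemma pos_image: "pos ` keys s M = {1..2 * k + s}"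
  using bij_betw_position[OF finite_keys] finite_card_keys by (simp add: bij_betw_def)

text \<open>Applied with the singleton key that ends a segment, this forces neighboring endpoints of
  arcs into one segment.\<close>

lemma pos_Suc_no_key_between:
  assumes "y \<in> keys s M" "z \<in> keys s M" "w \<in> keys s M" "pos z = Suc (pos y)" "y < w" "w < z"
  shows False
  using assms pos_less_iff by (metis less_Suc_eq not_less_eq)

lemma slot_arc_inj: "inj_on (slot_arc s M) (slots M)"
  by (auto simp: inj_on_def slot_arc_def pos_eq_iff keys_intros opener_key_inj)

lemma card_matrix_arcs: "card (matrix_arcs s M) = k"
  using finite_card_slots slot_arc_inj by (simp add: matrix_arcs_def card_image)

text \<open>Every condition on vertices becomes a lexicographic comparison of keys.\<close>

lemma arc_system_matrix_arcs: "arc_system (2 * k + s) (matrix_arcs s M)"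
proof
  fix i j
  assume "(i, j) \<in> matrix_arcs s M"
  then obtain p q t where c: "(p, q, t) \<in> slots M" and ij: "i = pos (p, 0, q, t)" "j = pos (q, 1, p, t)"
    by (auto simp: matrix_arcs_def slot_arc_def)
  have "pos (p, 0, q, t) \<in> {1..2 * k + s}" "pos (q, 1, p, t) \<in> {1..2 * k + s}"
    using keys_intros(1,2)[OF c] pos_image by auto
  \<comment> \<open>Since \<open>p \<le> q\<close>, the opener precedes the closer; for
    \<open>p = q\<close> the kinds 0 and 1 decide.\<close>
  moreover have "pos (p, 0, q, t) < pos (q, 1, p, t)"
    using keys_intros(1,2)[OF c] slot_bounds[OF c] by (simp add: pos_less_iff)
  ultimately show "1 \<le> i \<and> i < j \<and> j \<le> 2 * k + s"
    using ij by auto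
next
  fix a b
  assume "a \<in> matrix_arcs s M" "b \<in> matrix_arcs s M" "{fst a, snd a} \<inter> {fst b, snd b} \<noteq> {}"
  moreover from this obtain c d where "c \<in> slots M" "a = slot_arc s M c" "d \<in> slots M" "b = slot_arc s M d"
    by (auto simp: matrix_arcs_def)
  ultimately show "a = b"
    using key_kinds_distinct(1)[of c d] key_kinds_distinct(1)[of d c]
    by (auto simp: slot_arc_def pos_eq_iff keys_intros opener_key_inj closer_key_inj)
next
  fix i x j
  assume "(i, x) \<in> matrix_arcs s M"
  then obtain p q t where c: "(p, q, t) \<in> slots M" and x: "x = pos (q, 1, p, t)"
    by (auto simp: matrix_arcs_def slot_arc_def)
  show "(Suc x, j) \<notin> matrix_arcs s M"
  proof
    assume "(Suc x, j) \<in> matrix_arcs s M"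
    then obtain p' q' t' where c': "(p', q', t') \<in> slots M" and x': "Suc x = pos (p', 0, q', t')"
      by (auto simp: matrix_arcs_def slot_arc_def)
    have "pos (q, 1, p, t) < pos (p', 0, q', t')"
      using x x' by simp
    \<comment> \<open>Equality is excluded because within a segment the openers come first.\<close>
    then have "q < p'"
      using keys_intros(2)[OF c] keys_intros(1)[OF c'] by (simp add: pos_less_iff)
    \<comment> \<open>\<open>single_key q\<close> is a key, as \<open>q < p' \<le> s\<close>, and it
      lies strictly between the two neighbors.\<close>
    then show False
      using pos_Suc_no_key_between[of "(q, 1, p, t)" "(p', 0, q', t')" "single_key q"]
        keys_intros(2)[OF c] keys_intros(1)[OF c'] keys_intros(3)[of q] x x' slot_bounds[OF c']
      by (simp add: single_key_def)
  qed
next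
  fix x j j'
  assume "(x, j) \<in> matrix_arcs s M" "(Suc x, j') \<in> matrix_arcs s M"
  then obtain p q t p' q' t' where c: "(p, q, t) \<in> slots M" "(p', q', t') \<in> slots M"
    and x: "x = pos (p, 0, q, t)" "Suc x = pos (p', 0, q', t')"
    and j: "j = pos (q, 1, p, t)" "j' = pos (q', 1, p', t')"
    by (auto simp: matrix_arcs_def slot_arc_def)
  note k = keys_intros(1,2)[OF c(1)] keys_intros(1,2)[OF c(2)]
  have "pos (p, 0, q, t) < pos (p', 0, q', t')" using x by simp
  then have less: "p < p' \<or> p = p' \<and> (q < q' \<or> q = q' \<and> t < t')"
    using k by (auto simp: pos_less_iff)
  \<comment> \<open>Otherwise \<open>single_key p\<close> would separate the two openers. With
    \<open>p = p'\<close>, the order by \<open>(q, t)\<close> is also the order of the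
    closers.\<close>
  have "\<not> p < p'"
    using pos_Suc_no_key_between[of "(p, 0, q, t)" "(p', 0, q', t')" "single_key p"]
      k keys_intros(3)[of p] x slot_bounds[OF c(2)]
    by (auto simp: single_key_def)
  with less show "j < j'"
    using k j by (auto simp: pos_less_iff)
next
  fix i i' x
  assume "(i, x) \<in> matrix_arcs s M" "(i', Suc x) \<in> matrix_arcs s M"
  then obtain p q t p' q' t' where c: "(p, q, t) \<in> slots M" "(p', q', t') \<in> slots M"
    and x: "x = pos (q, 1, p, t)" "Suc x = pos (q', 1, p', t')"
    and i: "i = pos (p, 0, q, t)" "i' = pos (p', 0, q', t')"
    by (auto simp: matrix_arcs_def slot_arc_def)
  note k = keys_intros(1,2)[OF c(1)] keys_intros(1,2)[OF c(2)]
  have "pos (q, 1, p, t) < pos (q', 1, p', t')" using x by simp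
  then have less: "q < q' \<or> q = q' \<and> (p < p' \<or> p = p' \<and> t < t')"
    using k by (auto simp: pos_less_iff)
  have "\<not> q < q'"
    using pos_Suc_no_key_between[of "(q, 1, p, t)" "(q', 1, p', t')" "single_key q"]
      k keys_intros(3)[of q] x slot_bounds[OF c(2)]
    by (auto simp: single_key_def)
  with less show "i < i'"
    using k i by (auto simp: pos_less_iff)
qed

lemma endpoints_matrix_arcs:
  "endpoints (matrix_arcs s M) = pos ` (opener_key ` slots M \<union> closer_key ` slots M)"
  by (simp add: endpoints_def matrix_arcs_def slot_arc_def image_image image_Un)

lemma non_endpoints_matrix_arcs:
  "{1..2 * k + s} - endpoints (matrix_arcs s M) = pos ` single_key ` {..<s}"
proof -
  let ?E = "opener_key ` slots M \<union> closer_key ` slots M"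
  have "inj_on pos (keys s M)"
    using bij_betw_position[OF finite_keys] by (simp add: bij_betw_def)
  then have "pos ` keys s M - pos ` ?E = pos ` (keys s M - ?E)"
    by (subst inj_on_image_set_diff[of pos "keys s M"]) (auto simp: keys_def)
  moreover have "keys s M - ?E = single_key ` {..<s}"
    using key_kinds_distinct unfolding keys_def by blast
  ultimately show ?thesis
    by (simp add: endpoints_matrix_arcs pos_image)
qed

text \<open>The singleton keys below a non-singleton key of segment \<open>p\<close> are those with
  index less than \<open>p\<close>, and all of them exist because \<open>p \<le> s\<close>.\<close>

lemma segment_pos:
  assumes "(p, b, q, t) \<in> keys s M" "p \<le> s" "b < 2"
  shows "segment (matrix_arcs s M) (pos (p, b, q, t)) = p"
proof -
  have "pos (p, b, q, t) \<in> {1..2 * k + s}"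
    using assms(1) pos_image by blast
  then have "{1..<pos (p, b, q, t)} - endpoints (matrix_arcs s M)
      = {y \<in> pos ` single_key ` {..<s}. y < pos (p, b, q, t)}"
    unfolding non_endpoints_matrix_arcs[symmetric] by auto
  also have "\<dots> = (\<lambda>r. pos (single_key r)) ` {..<p}"
    using assms keys_intros(3) by (auto simp: pos_less_iff single_key_def)
  finally have "segment (matrix_arcs s M) (pos (p, b, q, t)) = card ((\<lambda>r. pos (single_key r)) ` {..<p})"
    by (simp add: segment_def)
  moreover have "inj_on (\<lambda>r. pos (single_key r)) {..<p}"
    using assms(2) keys_intros(3) by (auto simp: inj_on_def pos_eq_iff) (auto simp: single_key_def)
  ultimately show ?thesis
    by (simp add: card_image)
qed

lemma segments_slot_arc:
  assumes "(p, q, t) \<in> slots M"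
  shows "segments (matrix_arcs s M) (slot_arc s M (p, q, t)) = (p, q)"
  using segment_pos[of p 0 q t] segment_pos[of q 1 p t] keys_intros(1,2)[OF assms] slot_bounds[OF assms]
  by (simp add: segments_def slot_arc_def)

text \<open>First half of the bijection: a slot's arc has the segments that the slot records, so
  cell \<open>(p, q)\<close> holds one arc per \<open>t < M (p, q)\<close>.\<close>

lemma arc_matrix_matrix_arcs: "arc_matrix (matrix_arcs s M) = M"
proof
  fix c :: "nat \<times> nat"
  obtain p q where c: "c = (p, q)" by fastforce
  have "{a \<in> matrix_arcs s M. segments (matrix_arcs s M) a = c} = (\<lambda>t. slot_arc s M (p, q, t)) ` {..<M c}"
  proof (rule set_eqI, rule iffI)
    fix a assume "a \<in> {a \<in> matrix_arcs s M. segments (matrix_arcs s M) a = c}"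
    then obtain p' q' t where slot: "(p', q', t) \<in> slots M" and a: "a = slot_arc s M (p', q', t)"
      and seg: "segments (matrix_arcs s M) a = c"
      by (auto simp: matrix_arcs_def)
    have "p' = p" "q' = q"
      using segments_slot_arc[OF slot] seg a c by auto
    then show "a \<in> (\<lambda>t. slot_arc s M (p, q, t)) ` {..<M c}"
      using slot a c by (auto simp: slots_def)
  next
    fix a assume "a \<in> (\<lambda>t. slot_arc s M (p, q, t)) ` {..<M c}"
    then obtain t where "(p, q, t) \<in> slots M" "a = slot_arc s M (p, q, t)"
      by (auto simp: slots_def c)
    then show "a \<in> {a \<in> matrix_arcs s M. segments (matrix_arcs s M) a = c}"
      using segments_slot_arc by (auto simp: matrix_arcs_def c)
  qed
  moreover have "inj_on (\<lambda>t. slot_arc s M (p, q, t)) {..<M c}"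
    using slot_arc_inj by (auto simp: inj_on_def slots_def c)
  ultimately show "arc_matrix (matrix_arcs s M) c = M c"
    by (simp add: arc_matrix_def card_image)
qed

end

lemma segment_mono: "x \<le> y \<Longrightarrow> segment A x \<le> segment A y"
  unfolding segment_def by (intro card_mono) auto

lemma segment_Suc:
  assumes "1 \<le> x"
  shows "segment A (Suc x) = segment A x + (if x \<in> endpoints A then 0 else 1)"
proof -
  have "{1..<Suc x} = insert x {1..<x}" using assms by auto
  then show ?thesis by (simp add: segment_def insert_Diff_if)
qed

subsection \<open>From arc systems to matrices\<close>

context arc_system
begin

lemma finite_arcs: "finite A"
  by (rule finite_subset[of _ "{1..m} \<times> {1..m}"]) (use bounds in fastforce)+

lemma bounds': "a \<in> A \<Longrightarrow> 1 \<le> fst a \<and> fst a < snd a \<and> snd a \<le> m"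
  using bounds[of "fst a" "snd a"] by simp

lemma fst_inj: "a \<in> A \<Longrightarrow> b \<in> A \<Longrightarrow> fst a = fst b \<Longrightarrow> a = b"
  using disjoint[of a b] by simp

lemma snd_inj: "a \<in> A \<Longrightarrow> b \<in> A \<Longrightarrow> snd a = snd b \<Longrightarrow> a = b"
  using disjoint[of a b] by simp

lemma fst_neq_snd: "a \<in> A \<Longrightarrow> b \<in> A \<Longrightarrow> fst a \<noteq> snd b"
  using disjoint[of a b] bounds'[of a] by auto

lemma vertex_key_fst: "a \<in> A \<Longrightarrow> vertex_key A (fst a) = opener_key (arc_slot A a)"
proof -
  assume a: "a \<in> A"
  then have "(THE b. b \<in> A \<and> fst b = fst a) = a" using fst_inj by blast
  with a show ?thesis by (simp add: vertex_key_def)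
qed

lemma vertex_key_snd: "a \<in> A \<Longrightarrow> vertex_key A (snd a) = closer_key (arc_slot A a)"
proof -
  assume a: "a \<in> A"
  then have "(THE b. b \<in> A \<and> snd b = snd a) = a" using snd_inj by blast
  moreover have "snd a \<notin> fst ` A" using a fst_neq_snd by fastforce
  ultimately show ?thesis using a by (simp add: vertex_key_def)
qed

lemma vertex_key_single: "x \<notin> endpoints A \<Longrightarrow> vertex_key A x = single_key (segment A x)"
  by (simp add: vertex_key_def endpoints_def)

lemma arc_rank_mono:
  assumes "a \<in> A" "segments A a = segments A b" "fst a < fst b"
  shows "arc_rank A a < arc_rank A b"
  unfolding arc_rank_def using assms finite_arcs by (intro psubset_card_mono) auto

text \<open>The heart of the reconstruction. After a singleton the segment grows. After an endpoint
  it stays the same, \<open>no_alignment\<close> rules out closer before opener, and equal kinds are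
  compared by partner segment and then by rank.\<close>

lemma vertex_key_less_Suc:
  assumes "1 \<le> x"
  shows "vertex_key A x < vertex_key A (Suc x)"
proof (cases "x \<in> endpoints A")
  case False
  then have "fst (vertex_key A x) < segment A (Suc x)"
    using segment_Suc[OF assms, of A] by (simp add: vertex_key_single single_key_def)
  \<comment> \<open>All three kinds of key begin with the segment of the vertex itself.\<close>
  moreover have "fst (vertex_key A (Suc x)) = segment A (Suc x)"
  proof (cases "Suc x \<in> endpoints A")
    case True
    then show ?thesis
      by (auto simp: endpoints_def vertex_key_fst vertex_key_snd arc_slot_def)
         (metis vertex_key_fst vertex_key_snd arc_slot_def opener_key.simps closer_key.simps fst_conv snd_conv)+
  qed (simp add: vertex_key_single single_key_def)
  ultimately show ?thesis by (simp add: less_prod_def)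
next
  case x: True
  then have seg: "segment A (Suc x) = segment A x"
    using segment_Suc[OF assms, of A] by simp
  show ?thesis
  proof (cases "Suc x \<in> endpoints A")
    case False
    from x obtain a where a: "a \<in> A" "x = fst a \<or> x = snd a" by (auto simp: endpoints_def)
    \<comment> \<open>Kinds 0 and 1 are below kind 2.\<close>
    with False seg show ?thesis
      by (auto simp: vertex_key_fst vertex_key_snd vertex_key_single arc_slot_def single_key_def)
  next
    case Suc_x: True
    from x obtain a where a: "a \<in> A" "x = fst a \<or> x = snd a" by (auto simp: endpoints_def)
    from Suc_x obtain b where b: "b \<in> A" "Suc x = fst b \<or> Suc x = snd b" by (auto simp: endpoints_def)
    consider "x = fst a" "Suc x = fst b" | "x = fst a" "Suc x = snd b"
      | "x = snd a" "Suc x = fst b" | "x = snd a" "Suc x = snd b"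
      using a b by blast
    then show ?thesis
    proof cases
      case 1
      then have "snd a < snd b"
        using a(1) b(1) openers_increasing[of x "snd a" "snd b"] by (metis prod.collapse)
      then have "segment A (snd a) \<le> segment A (snd b)" by (intro segment_mono) simp
      moreover have "arc_rank A a < arc_rank A b" if "segment A (snd a) = segment A (snd b)"
        using 1 a(1) seg that by (intro arc_rank_mono) (auto simp: segments_def)
      ultimately show ?thesis
        using vertex_key_fst[OF a(1)] vertex_key_fst[OF b(1)] 1 seg
        by (auto simp: arc_slot_def le_less)
    next
      case 2
      then show ?thesis
        using vertex_key_fst[OF a(1)] vertex_key_snd[OF b(1)] seg by (auto simp: arc_slot_def)
    next
      case 3
      then show ?thesis
        using a(1) b(1) no_alignment[of "fst a" x "snd b"] by (metis prod.collapse)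
    next
      case 4
      then have "fst a < fst b"
        using a(1) b(1) closers_increasing[of "fst a" x "fst b"] by (metis prod.collapse)
      then have "segment A (fst a) \<le> segment A (fst b)" by (intro segment_mono) simp
      \<comment> \<open>Ranks follow the openers, so the order of the two closers is first
        transferred to the openers by \<open>closers_increasing\<close>.\<close>
      moreover have "arc_rank A a < arc_rank A b" if "segment A (fst a) = segment A (fst b)"
        using 4 a(1) seg that \<open>fst a < fst b\<close> by (intro arc_rank_mono) (auto simp: segments_def)
      ultimately show ?thesis
        using vertex_key_snd[OF a(1)] vertex_key_snd[OF b(1)] 4 seg
        by (auto simp: arc_slot_def le_less)
    qed
  qed
qed

lemma strict_mono_vertex_key: "strict_mono_on {1..n} (vertex_key A)"
proof (rule strict_mono_onI)
  fix x y assume "x \<in> {1..n}" "x < y"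
  then have "1 \<le> x" by simp
  \<comment> \<open>The bound on \<open>x\<close> stays in the goal because the induction varies
    both ends.\<close>
  from \<open>x < y\<close> have "1 \<le> x \<longrightarrow> vertex_key A x < vertex_key A y"
    by (induction rule: less_Suc_induct) (use vertex_key_less_Suc in \<open>auto intro: less_trans\<close>)
  then show "vertex_key A x < vertex_key A y" using \<open>1 \<le> x\<close> by simp
qed

lemma card_endpoints: "endpoints A \<subseteq> {1..m} \<and> card (endpoints A) = 2 * card A"
proof
  show "endpoints A \<subseteq> {1..m}"
    using bounds' by (fastforce simp: endpoints_def)
  have "card (fst ` A) = card A" "card (snd ` A) = card A"
    using fst_inj snd_inj by (auto intro!: card_image inj_onI)
  moreover have "fst ` A \<inter> snd ` A = {}"
    using fst_neq_snd by fastforce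
  ultimately show "card (endpoints A) = 2 * card A"
    using finite_arcs by (simp add: endpoints_def card_Un_disjoint)
qed

text \<open>The arc \<open>a\<close> is in its own cell but not among the arcs that its rank counts,
  so the inequality is strict.\<close>

lemma arc_slot_in_slots: "a \<in> A \<Longrightarrow> arc_slot A a \<in> slots (arc_matrix A)"
proof -
  assume "a \<in> A"
  then have "arc_rank A a < arc_matrix A (segments A a)"
    unfolding arc_rank_def arc_matrix_def using finite_arcs by (intro psubset_card_mono) auto
  then show ?thesis by (simp add: arc_slot_def slots_def segments_def)
qed

context
  fixes s assumes m: "m = 2 * card A + s"
begin

lemma card_non_endpoints: "card ({1..m} - endpoints A) = s"
  using card_endpoints m finite_subset[of "endpoints A" "{1..m}"] by (simp add: card_Diff_subset)

lemma segment_le: "x \<le> m \<Longrightarrow> segment A x \<le> s"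
  unfolding segment_def card_non_endpoints[symmetric] by (intro card_mono) auto

lemma segment_less: "x \<in> {1..m} - endpoints A \<Longrightarrow> segment A x < s"
  unfolding segment_def card_non_endpoints[symmetric] by (intro psubset_card_mono) auto

lemma segments_triangular: "a \<in> A \<Longrightarrow> segments A a \<in> {(p, q). p \<le> q \<and> q \<le> s}"
  using bounds'[of a] by (simp add: segments_def segment_mono segment_le)

lemma arc_matrix_triangular: "arc_matrix A \<in> triangular_matrices s (card A)"
  unfolding triangular_matrices_def
proof (intro CollectI conjI allI impI)
  fix c assume "c \<notin> {(p, q). p \<le> q \<and> q \<le> s}"
  then have "segments A a \<noteq> c" if "a \<in> A" for a
    using segments_triangular[OF that] by metis
  then have "{a \<in> A. segments A a = c} = {}" by simp
  then show "arc_matrix A c = 0" by (simp only: arc_matrix_def card.empty)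
next
  have "(\<Sum>c\<in>{(p, q). p \<le> q \<and> q \<le> s}. sum (\<lambda>_. 1) {a \<in> A. segments A a = c}) = sum (\<lambda>_. 1 :: nat) A"
    by (rule sum.group[OF finite_arcs finite_weak_upper_triangle image_subsetI[OF segments_triangular]])
  then show "sum (arc_matrix A) {(p, q). p \<le> q \<and> q \<le> s} = card A"
    by (simp add: arc_matrix_def)
qed

text \<open>One inclusion suffices: \<open>vertex_key A\<close> is injective and there are exactly
  \<open>m\<close> keys.\<close>

lemma vertex_key_image: "vertex_key A ` {1..m} = keys s (arc_matrix A)"
proof (rule card_subset_eq)
  note K = finite_card_keys[OF arc_matrix_triangular]
  show "finite (keys s (arc_matrix A))" using K by blast
  show "card (vertex_key A ` {1..m}) = card (keys s (arc_matrix A))"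
    using strict_mono_on_imp_inj_on[OF strict_mono_vertex_key, of m] K m by (simp add: card_image)
  show "vertex_key A ` {1..m} \<subseteq> keys s (arc_matrix A)"
  proof (rule image_subsetI)
    fix x assume x: "x \<in> {1..m}"
    show "vertex_key A x \<in> keys s (arc_matrix A)"
    proof (cases "x \<in> endpoints A")
      case True
      then obtain a where "a \<in> A" "x = fst a \<or> x = snd a" by (auto simp: endpoints_def)
      then show ?thesis
        using vertex_key_fst[of a] vertex_key_snd[of a] arc_slot_in_slots[of a] by (auto simp: keys_def)
    next
      case False
      then show ?thesis
        using segment_less x by (simp add: vertex_key_single keys_def)
    qed
  qed
qed

text \<open>Second half of the bijection: \<open>position\<close> returns each vertex from its key,
  so every arc of \<open>A\<close> is the arc of its own slot. Equal cardinalities give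
  equality.\<close>

lemma matrix_arcs_arc_matrix: "matrix_arcs s (arc_matrix A) = A"
proof -
  have pos: "position (keys s (arc_matrix A)) (vertex_key A x) = x" if "x \<in> {1..m}" for x
    using position_unique[OF strict_mono_vertex_key that] by (simp only: vertex_key_image)
  have "A \<subseteq> matrix_arcs s (arc_matrix A)"
  proof
    fix a assume a: "a \<in> A"
    then have "slot_arc s (arc_matrix A) (arc_slot A a) = (fst a, snd a)"
      using pos[of "fst a"] pos[of "snd a"] bounds'[OF a]
      by (simp add: slot_arc_def vertex_key_fst vertex_key_snd)
    then show "a \<in> matrix_arcs s (arc_matrix A)"
      using arc_slot_in_slots[OF a] by (force simp: matrix_arcs_def)
  qed
  moreover have "finite (matrix_arcs s (arc_matrix A))"
    using finite_card_slots[OF arc_matrix_triangular] by (simp add: matrix_arcs_def)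
  ultimately show ?thesis
    using card_matrix_arcs[OF arc_matrix_triangular] by (metis card_subset_eq)
qed

end

end

lemma card_arc_systems: "card (arc_systems s k) = (k + ((s + 2) choose 2) - 1) choose k"
proof -
  have "bij_betw arc_matrix (arc_systems s k) (triangular_matrices s k)"
    by (rule bij_betw_byWitness[where f' = "matrix_arcs s"])
       (auto simp: arc_systems_def arc_system.matrix_arcs_arc_matrix arc_matrix_matrix_arcs
         arc_system.arc_matrix_triangular arc_system_matrix_arcs card_matrix_arcs)
  then show ?thesis
    using card_weighted_functions[OF finite_weak_upper_triangle, of s k]
    by (simp add: bij_betw_same_card triangular_matrices_def card_weak_upper_triangle)
qed

subsection \<open>Partial matchings as arc systems\<close>

lemma partial_matching_card_le_2:
  assumes "partial_matching m P" "B \<in> P"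
  obtains x where "B = {x}" "x \<in> {1..m}"
    | i j where "B = {i, j}" "i < j" "i \<in> {1..m}" "j \<in> {1..m}"
proof -
  have B: "B \<noteq> {}" "B \<subseteq> {1..m}" "card B \<le> 2"
    using assms by (auto simp: partial_matching_def partition_on_def)
  then have "finite B" by (auto intro: finite_subset)
  with B have "card B = 1 \<or> card B = 2" by (metis card_0_eq le_SucE le_zero_eq numeral_2_eq_2 One_nat_def)
  then show ?thesis
  proof
    assume "card B = 1"
    then show ?thesis using B that(1) by (auto simp: card_1_singleton_iff)
  next
    assume "card B = 2"
    then obtain i j where "B = {i, j}" "i \<noteq> j" by (auto simp: card_2_iff)
    then show ?thesis using B that(2)[of i j] that(2)[of j i] by (cases "i < j") auto
  qed
qed

text \<open>For fixed \<open>m\<close> the arcs determine the matching, which makes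
  \<open>arcs\<close> injective.\<close>

lemma partial_matching_eq:
  assumes "partial_matching m P"
  shows "P = (\<lambda>(i, j). {i, j}) ` arcs P \<union> (\<lambda>x. {x}) ` ({1..m} - endpoints (arcs P))" (is "P = ?Q")
proof
  show "P \<subseteq> ?Q"
  proof
    fix B assume B: "B \<in> P"
    from assms B show "B \<in> ?Q"
    proof (cases rule: partial_matching_card_le_2)
      case (1 x)
      have "x \<notin> endpoints (arcs P)"
      proof
        assume "x \<in> endpoints (arcs P)"
        then obtain i j where "i < j" "{i, j} \<in> P" "x \<in> {i, j}"
          by (auto simp: endpoints_def arcs_def)
        \<comment> \<open>Both blocks contain \<open>x\<close>, and distinct blocks are
          disjoint.\<close>
        moreover from this have "{i, j} = B"
          using disjointD[OF partition_onD2, of "{1..m}" P "{i, j}" B] assms B 1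
          by (auto simp: partial_matching_def)
        ultimately show False using 1 by auto
      qed
      with 1 show ?thesis by auto
    next
      case (2 i j)
      with B show ?thesis by (force simp: arcs_def)
    qed
  qed
  show "?Q \<subseteq> P"
  proof
    fix B assume "B \<in> ?Q"
    then show "B \<in> P"
    proof
      assume "B \<in> (\<lambda>x. {x}) ` ({1..m} - endpoints (arcs P))"
      then obtain x where x: "x \<in> {1..m}" "x \<notin> endpoints (arcs P)" "B = {x}" by auto
      moreover have "\<Union>P = {1..m}"
        using assms by (simp add: partial_matching_def partition_on_def)
      ultimately obtain C where C: "C \<in> P" "x \<in> C" by blast
      from assms C(1) show "B \<in> P"
      proof (cases rule: partial_matching_card_le_2)
        case (1 y)
        then show ?thesis using C x by auto
      next
        case (2 i j)
        then have "(i, j) \<in> arcs P" using C by (simp add: arcs_def)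
        then show ?thesis using 2 C x by (force simp: endpoints_def)
      qed
    qed (auto simp: arcs_def)
  qed
qed

text \<open>Bounds and disjointness hold for every matching; the other conditions correspond one by
  one to the forbidden patterns.\<close>

lemma arc_system_arcs_iff:
  assumes "partial_matching m P"
  shows "arc_system m (arcs P) \<longleftrightarrow> (\<forall>a\<in>arcs P. \<forall>b\<in>arcs P.
    \<not> neighbor_alignment a b \<and> \<not> left_nesting a b \<and> \<not> right_nesting a b)" (is "_ \<longleftrightarrow> ?N")
proof
  assume "arc_system m (arcs P)"
  then interpret arc_system m "arcs P" .
  show ?N
  proof (intro ballI conjI notI)
    fix a b assume ab: "a \<in> arcs P" "b \<in> arcs P"
    obtain i j i' j' where eq: "a = (i, j)" "b = (i', j')" by fastforce
    { assume "neighbor_alignment a b"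
      then show False using ab eq no_alignment[of i j j'] by (auto simp: neighbor_alignment_def) }
    { assume "left_nesting a b"
      then show False
        using ab eq openers_increasing[of i j j'] by (auto simp: left_nesting_def nesting_def) }
    \<comment> \<open>The outer arc \<open>a\<close> closes last, so
      \<open>closers_increasing\<close> is applied with \<open>b\<close> first.\<close>
    { assume "right_nesting a b"
      then show False
        using ab eq closers_increasing[of i' j' i] by (auto simp: right_nesting_def nesting_def) }
  qed
next
  assume N: ?N
  have part: "partition_on {1..m} P" using assms by (simp add: partial_matching_def)
  have bounds: "1 \<le> i \<and> i < j \<and> j \<le> m" if "(i, j) \<in> arcs P" for i j
    using that partition_onD1[OF part] by (auto simp: arcs_def)
  have disj: "a = b" if "a \<in> arcs P" "b \<in> arcs P" "{fst a, snd a} \<inter> {fst b, snd b} \<noteq> {}" for a b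
  proof -
    have "{fst a, snd a} \<in> P" "{fst b, snd b} \<in> P" "fst a < snd a" "fst b < snd b"
      using that by (auto simp: arcs_def)
    moreover from this have "{fst a, snd a} = {fst b, snd b}"
      using disjointD[OF partition_onD2[OF part]] that(3) by blast
    ultimately show ?thesis by (auto simp: doubleton_eq_iff prod_eq_iff)
  qed
  show "arc_system m (arcs P)"
  proof
    fix i x j assume "(i, x) \<in> arcs P"
    then show "(Suc x, j) \<notin> arcs P"
      using N bounds[of i x] bounds[of "Suc x" j] by (fastforce simp: neighbor_alignment_def)
  next
    fix x j j' assume a: "(x, j) \<in> arcs P" "(Suc x, j') \<in> arcs P"
    then have "\<not> left_nesting (x, j) (Suc x, j')" using N by blast
    \<comment> \<open>Absence of a nesting only excludes \<open>j' < j\<close>; disjointness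
      excludes equality.\<close>
    moreover have "j \<noteq> j'" using disj[OF a] by auto
    ultimately show "j < j'"
      using bounds[OF a(2)] by (auto simp: left_nesting_def nesting_def)
  next
    fix i i' x assume a: "(i, x) \<in> arcs P" "(i', Suc x) \<in> arcs P"
    then have "\<not> right_nesting (i', Suc x) (i, x)" using N by blast
    moreover have "i \<noteq> i'" using disj[OF a] by auto
    ultimately show "i < i'"
      using bounds[OF a(1)] by (auto simp: right_nesting_def nesting_def)
  qed (use bounds disj in blast)+
qed

text \<open>Surjectivity of \<open>arcs\<close> onto arc systems: uncovered vertices become
  singletons.\<close>

lemma partial_matching_of_arcs:
  assumes "arc_system m A"
  defines "P \<equiv> (\<lambda>(i, j). {i, j}) ` A \<union> (\<lambda>x. {x}) ` ({1..m} - endpoints A)"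
  shows "partial_matching m P" "arcs P = A"
proof -
  interpret arc_system m A by fact
  have "\<Union>P = endpoints A \<union> ({1..m} - endpoints A)"
    by (force simp: P_def endpoints_def)
  then have "\<Union>P = {1..m}" using card_endpoints by auto
  moreover have "disjoint P"
  proof (rule disjointI)
    fix B C assume BC: "B \<in> P" "C \<in> P" "B \<noteq> C"
    \<comment> \<open>Intersecting arcs coincide by \<open>disjoint\<close>, and an arc cannot meet
      a singleton, which avoids \<open>endpoints A\<close>.\<close>
    have block: "(\<exists>a\<in>A. D = {fst a, snd a}) \<or> (\<exists>x. D = {x} \<and> x \<notin> endpoints A)" if "D \<in> P" for D
      using that by (auto simp: P_def split_beta)
    have sub: "{fst a, snd a} \<subseteq> endpoints A" if "a \<in> A" for a
      using that by (simp add: endpoints_def)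
    show "B \<inter> C = {}"
    proof (rule ccontr)
      assume meet: "B \<inter> C \<noteq> {}"
      from block[OF BC(1)] block[OF BC(2)] show False
      proof (elim disjE bexE exE conjE)
        fix a b assume "a \<in> A" "B = {fst a, snd a}" "b \<in> A" "C = {fst b, snd b}"
        with disjoint[of a b] meet BC(3) show False by simp
      next
        fix a x assume "a \<in> A" "B = {fst a, snd a}" "C = {x}" "x \<notin> endpoints A"
        with sub[of a] meet show False by auto
      next
        fix a x assume "a \<in> A" "C = {fst a, snd a}" "B = {x}" "x \<notin> endpoints A"
        with sub[of a] meet show False by auto
      next
        fix x y assume "B = {x}" "C = {y}"
        with meet BC(3) show False by simp
      qed
    qed
  qed
  moreover have "{} \<notin> P" "\<forall>B\<in>P. card B \<le> 2"
    by (auto simp: P_def card_insert_if)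
  ultimately show "partial_matching m P"
    by (simp add: partial_matching_def partition_on_def)
  show "arcs P = A"
    using bounds by (fastforce simp: arcs_def P_def doubleton_eq_iff)
qed

lemma R_eq_card_arc_systems: "R (2 * k + s) k = card (arc_systems s k)"
proof -
  let ?m = "2 * k + s"
  let ?f = "\<lambda>A. (\<lambda>(i, j). {i, j}) ` A \<union> (\<lambda>x. {x}) ` ({1..?m} - endpoints A)"
  let ?P = "{P. partial_matching ?m P \<and> card (arcs P) = k \<and>
     (\<forall>a\<in>arcs P. \<forall>b\<in>arcs P.
        \<not> neighbor_alignment a b \<and> \<not> left_nesting a b \<and> \<not> right_nesting a b)}"
  have P: "?P = {P. partial_matching ?m P \<and> card (arcs P) = k \<and> arc_system ?m (arcs P)}"
    using arc_system_arcs_iff by blast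
  have "bij_betw arcs ?P (arc_systems s k)"
    unfolding P
  proof (rule bij_betw_byWitness[where f' = ?f])
    show "\<forall>P\<in>{P. partial_matching ?m P \<and> card (arcs P) = k \<and> arc_system ?m (arcs P)}. ?f (arcs P) = P"
      using partial_matching_eq by blast
    show "\<forall>A\<in>arc_systems s k. arcs (?f A) = A"
      unfolding arc_systems_def using partial_matching_of_arcs(2) by blast
    show "?f ` arc_systems s k \<subseteq> {P. partial_matching ?m P \<and> card (arcs P) = k \<and> arc_system ?m (arcs P)}"
      unfolding arc_systems_def using partial_matching_of_arcs by fastforce
  qed (auto simp: arc_systems_def)
  then show ?thesis by (simp add: R_def bij_betw_same_card)
qed

lemma R_eq_binomial:
  assumes "k < n"
  shows "R (n + k - 1) k = (((n - k + 1) choose 2) + k - 1) choose k"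
proof -
  \<comment> \<open>With \<open>n + k - 1\<close> vertices and \<open>k\<close> arcs, this is the
    number of singletons; \<open>k < n\<close> keeps the subtraction exact.\<close>
  define s where "s = n - k - 1"
  have "n + k - 1 = 2 * k + s" "n - k + 1 = s + 2" using assms by (auto simp: s_def)
  then show ?thesis
    by (simp only: R_eq_card_arc_systems card_arc_systems add.commute[of k "(s + 2) choose 2"])
qed

subsection \<open>Generating functions\<close>

text \<open>Coefficient \<open>N\<close> of a finite partial sum is constant once the index set
  contains \<open>1..N\<close>, since later terms start beyond degree \<open>N\<close>.\<close>

lemma has_sum_fps_X_adic:
  fixes f :: "nat \<Rightarrow> 'a :: ring_1 fps"
  assumes "\<And>n i. i < n \<Longrightarrow> fps_nth (f n) i = 0"
  shows "(f has_sum Abs_fps (\<lambda>N. \<Sum>n=1..N. fps_nth (f n) N)) {1..}"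
  unfolding has_sum_def
proof (rule tendsto_fpsI)
  fix N :: nat
  have "\<forall>\<^sub>F F in finite_subsets_at_top {1..}. {1..N} \<subseteq> F \<and> F \<subseteq> {1..} \<and> finite F"
    unfolding eventually_finite_subsets_at_top by (intro exI[of _ "{1..N}"]) auto
  then show "\<forall>\<^sub>F F in finite_subsets_at_top {1..}.
     fps_nth (sum f F) N = fps_nth (Abs_fps (\<lambda>N. \<Sum>n=1..N. fps_nth (f n) N)) N"
  proof (rule eventually_mono)
    fix F :: "nat set"
    assume F: "{1..N} \<subseteq> F \<and> F \<subseteq> {1..} \<and> finite F"
    have "(\<Sum>n=1..N. fps_nth (f n) N) = (\<Sum>n\<in>F. fps_nth (f n) N)"
    proof (rule sum.mono_neutral_left)
      show "\<forall>n\<in>F - {1..N}. fps_nth (f n) N = 0"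
        using F assms by (metis DiffD1 DiffD2 atLeastAtMost_iff atLeast_iff not_le subsetD)
    qed (use F in auto)
    then show "fps_nth (sum f F) N = fps_nth (Abs_fps (\<lambda>N. \<Sum>n=1..N. fps_nth (f n) N)) N"
      by (simp add: fps_sum_nth)
  qed
qed

text \<open>The negative binomial series, by induction on the exponent. The inner
  \<open>fps_X\<close> is the variable \<open>Y\<close>.\<close>

lemma mult_one_minus_XY_power:
  "Abs_fps (\<lambda>j. of_nat ((c + j - 1) choose j) * fps_X ^ j) * (1 - X * Y) ^ c = 1"
proof (induction c)
  case 0
  \<comment> \<open>At \<open>j = 0\<close> truncated subtraction gives
    \<open>0 choose 0 = 1\<close>; all other coefficients vanish.\<close>
  have "Abs_fps (\<lambda>j. of_nat ((j - 1) choose j) * fps_X ^ j) = (1 :: rat fps fps)"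
    by (rule fps_ext) (auto simp: binomial_eq_0)
  then show ?case by simp
next
  case (Suc c)
  let ?h = "\<lambda>c. Abs_fps (\<lambda>j. of_nat ((c + j - 1) choose j) * fps_X ^ j) :: rat fps fps"
  have "?h (Suc c) * (1 - X * Y) = ?h c"
  proof (rule fps_ext)
    fix j
    have "?h (Suc c) * (1 - X * Y) = ?h (Suc c) - fps_X * (fps_const fps_X * ?h (Suc c))"
      by (simp add: X_def Y_def algebra_simps)
    moreover have "fps_nth (?h (Suc c) - fps_X * (fps_const fps_X * ?h (Suc c))) j = fps_nth (?h c) j"
    proof (cases j)
      case (Suc i)
      \<comment> \<open>Pascal's rule removes one factor \<open>1 - X * Y\<close>.\<close>
      have "of_nat (Suc (c + i) choose Suc i) = of_nat (c + i choose Suc i) + (of_nat (c + i choose i) :: rat fps)"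
        by simp
      then show ?thesis by (simp add: Suc algebra_simps)
    qed simp
    ultimately show "fps_nth (?h (Suc c) * (1 - X * Y)) j = fps_nth (?h c) j" by simp
  qed
  then show ?case using Suc by (simp add: mult.assoc[symmetric])
qed

text \<open>Turns each quotient into a product whose coefficients can be read off.\<close>

lemma divide_one_minus_XY_power_eq:
  "f / (1 - X * Y) ^ c = f * Abs_fps (\<lambda>j. of_nat ((c + j - 1) choose j) * fps_X ^ j)"
    (is "_ = f * ?h")
proof -
  have "f / (1 - X * Y) ^ c = f / (1 - X * Y) ^ c * (?h * (1 - X * Y) ^ c)"
    by (simp only: mult_one_minus_XY_power mult_1_right)
  also have "\<dots> = f / (1 - X * Y) ^ c * (1 - X * Y) ^ c * ?h"
    by (simp only: mult_ac)
  also have "\<dots> = f * ?h"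
    by (simp only: divide_one_minus_xy_power)
  finally show ?thesis .
qed

theorem theorem1p3:
  shows "(\<lambda>n. \<Sum>k=0..n-1. of_nat (R (n + k - 1) k) * X ^ n * Y ^ k) summable_on {1..} \<and>
    (\<lambda>n. X ^ n / (1 - X * Y) ^ ((n + 1) choose 2)) summable_on {1..} \<and>
    (\<Sum>\<^sub>\<infinity>n\<in>{1..}. \<Sum>k=0..n-1. of_nat (R (n + k - 1) k) * X ^ n * Y ^ k) =
    (\<Sum>\<^sub>\<infinity>n\<in>{1..}. X ^ n / (1 - X * Y) ^ ((n + 1) choose 2))"
proof -
  define f :: "nat \<Rightarrow> rat fps fps" where
    "f n = (\<Sum>k=0..n-1. of_nat (R (n + k - 1) k) * X ^ n * Y ^ k)" for n
  define g :: "nat \<Rightarrow> rat fps fps" where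
    "g n = X ^ n / (1 - X * Y) ^ ((n + 1) choose 2)" for n
  \<comment> \<open>Each \<open>f n\<close> is homogeneous of degree \<open>n\<close> in
    \<open>X\<close>, so coefficient \<open>N\<close> comes from \<open>n = N\<close> alone.\<close>
  have f_nth: "fps_nth (f n) N
    = (if N = n then \<Sum>k=0..n-1. of_nat (R (n + k - 1) k) * fps_X ^ k else 0)" for n N
  proof -
    have "of_nat r * X ^ n * Y ^ k = fps_X ^ n * fps_const (of_nat r * fps_X ^ k)" for r k
    proof -
      have "of_nat r * X ^ n * Y ^ k = fps_X ^ n * (of_nat r * fps_const (fps_X ^ k))"
        by (simp add: X_def Y_def mult_ac)
      then show ?thesis by (simp add: fps_of_nat[symmetric])
    qed
    then show ?thesis by (auto simp: f_def fps_sum_nth fps_X_power_mult_nth)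
  qed
  have g_nth: "fps_nth (g n) N
    = (if N < n then 0 else of_nat ((((n + 1) choose 2) + (N - n) - 1) choose (N - n)) * fps_X ^ (N - n))" for n N
    unfolding g_def divide_one_minus_XY_power_eq by (simp add: X_def fps_X_power_mult_nth)
  have eq: "(\<Sum>n=1..N. fps_nth (f n) N) = (\<Sum>n=1..N. fps_nth (g n) N)" for N
  proof (cases "N = 0")
    case False
    have "(\<Sum>n=1..N. fps_nth (f n) N) = (\<Sum>k=0..N-1. of_nat (R (N + k - 1) k) * fps_X ^ k)"
      using False by (simp add: f_nth)
    \<comment> \<open>The term \<open>x^(N-k) (xy)^k\<close> contributes \<open>y^k\<close> to the
      coefficient of \<open>x^N\<close>; hence \<open>k\<close> is paired with
      \<open>n = N - k\<close>.\<close>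
    also have "\<dots> = (\<Sum>k=0..N-1. fps_nth (g (N - k)) N)"
    proof (rule sum.cong)
      fix k assume "k \<in> {0..N-1}"
      with False have "k < N" by auto
      then show "of_nat (R (N + k - 1) k) * fps_X ^ k = fps_nth (g (N - k)) N"
        using R_eq_binomial[of k N] by (auto simp: g_nth)
    qed simp
    also have "\<dots> = (\<Sum>n=1..N. fps_nth (g n) N)"
      by (rule sum.reindex_bij_witness[of _ "\<lambda>n. N - n" "\<lambda>k. N - k"]) (use False in auto)
    finally show ?thesis .
  qed simp
  have "(f has_sum Abs_fps (\<lambda>N. \<Sum>n=1..N. fps_nth (f n) N)) {1..}"
    by (rule has_sum_fps_X_adic) (simp add: f_nth)
  moreover have "(g has_sum Abs_fps (\<lambda>N. \<Sum>n=1..N. fps_nth (f n) N)) {1..}"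
    unfolding eq by (rule has_sum_fps_X_adic) (simp add: g_nth)
  ultimately have "f summable_on {1..} \<and> g summable_on {1..} \<and> infsum f {1..} = infsum g {1..}"
    by (simp add: has_sum_imp_summable infsumI)
  then show ?thesis
    unfolding f_def g_def .
qed

end
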